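(* Let $\bar\zeta\in\mathbb{R}^m$ be the dual multipliers of the constraint $Z_\mathrm{d}=X_\mathrm{d}^*$ obtained from solving the Benders subproblem (BSP). Then the strengthened Benders optimality cut $$\Theta \ge c_\mathrm{c}^T\bar X_\mathrm{c}^{s}+\bar\zeta^T(X_\mathrm{d}-\bar Z_\mathrm{d}^{s})$$ is parallel to the generalized Benders optimality cut $$\Theta \ge c_\mathrm{c}^T\bar X_\mathrm{c}+\bar\zeta^T(X_\mathrm{d}-\bar Z_\mathrm{d})$$ and at least $\Xi\ge 0$ units tighter, where $$\Xi=\min_{(X_\mathrm{c},Z_\mathrm{d})\in\mathcal{X},\ Z_\mathrm{d}\in\{0,1\}^m}\bigl(c_\mathrm{c}^TX_\mathrm{c}-\bar\zeta^TZ_\mathrm{d}\bigr)-\min_{(X_\mathrm{c},Z_\mathrm{d})\in\mathcal{X},\ Z_\mathrm{d}\in\mathbb{R}^m}\bigl(c_\mathrm{c}^TX_\mathrm{c}-\bar\zeta^TZ_\mathrm{d}\bigr).$$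
   Context: Consider the mixed-integer program $$\min_{X_\mathrm{d},X_\mathrm{c}}\ c_\mathrm{d}^TX_\mathrm{d}+c_\mathrm{c}^TX_\mathrm{c}\quad\text{s.t.}\quad A_\mathrm{d}X_\mathrm{d}+A_\mathrm{c}X_\mathrm{c}\le b_\mathrm{a},\quad B_\mathrm{d}X_\mathrm{d}+G(X_\mathrm{c})\le b_\mathrm{b},\quad D_\mathrm{d}X_\mathrm{d}\le b_\mathrm{c},\quad X_\mathrm{d}\in\{0,1\}^m,\ X_\mathrm{c}\in\mathbb{R}^n,$$ where $A_\mathrm{d},A_\mathrm{c},B_\mathrm{d},D_\mathrm{d}$ are coefficient matrices, $b_\mathrm{a},b_\mathrm{b},b_\mathrm{c},c_\mathrm{d},c_\mathrm{c}$ are coefficient vectors, and $G$ is a nonlinear function. Set: $\mathcal{X}=\{(X_\mathrm{c},Z_\mathrm{d}):\ A_\mathrm{d}Z_\mathrm{d}+A_\mathrm{c}X_\mathrm{c}\le b_\mathrm{a},\ B_\mathrm{d}Z_\mathrm{d}+G(X_\mathrm{c})\le b_\mathrm{b},\ D_\mathrm{d}Z_\mathrm{d}\le b_\mathrm{c},\ X_\mathrm{c}\in\mathbb{R}^n\}$. Benders master problem (BMP): minimize $c_\mathrm{d}^TX_\mathrm{d}+\Theta$ over $X_\mathrm{d}\in\{0,1\}^m$ and the auxiliary variable $\Theta$ (a lower bound of the objective value of the subproblem), subject to $D_\mathrm{d}X_\mathrm{d}\le b_\mathrm{c}$; cuts in $(X_\mathrm{d},\Theta)$ are added to it iteratively.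 $X_\mathrm{d}^*$ denotes the solution obtained from solving BMP (the algorithm may solve its linear relaxation). Benders subproblem (BSP): minimize $c_\mathrm{c}^TX_\mathrm{c}$ over $(X_\mathrm{c},Z_\mathrm{d})\in\mathcal{X}$, $Z_\mathrm{d}\in\mathbb{R}^m$, subject to $Z_\mathrm{d}=X_\mathrm{d}^*$, where $Z_\mathrm{d}$ is a local copy of the BMP variables. Its solution is $(\bar X_\mathrm{c},\bar Z_\mathrm{d})$, and the generalized Benders optimality cut is built from it and $\bar\zeta$. Strengthened subproblem: minimize $c_\mathrm{c}^TX_\mathrm{c}-\bar\zeta^T(Z_\mathrm{d}-X_\mathrm{d}^* )$ over $(X_\mathrm{c},Z_\mathrm{d})\in\mathcal{X}$ with $Z_\mathrm{d}\in\{0,1\}^m$. Its solution is $(\bar X_\mathrm{c}^{s},\bar Z_\mathrm{d}^{s})$, and the strengthened Benders optimality cut is built from it and $\bar\zeta$. "Parallel" means that the two right-hand sides, as affine functions of $X_\mathrm{d}$, have the same slope; "at least $\Xi$ units tighter" means that the right-hand side of the strengthened cut exceeds that of the generalized cut by at least $\Xi$.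
   Formalization: Dual multipliers are taken to be zero-gap Lagrange multipliers of Z_d = X_d^*: the minimum of c_c^T X_c − ζ^T(Z_d − X_d^* ) over the set X equals the BSP value. For nonconvex G, multipliers with a duality gap make the claim false. *)

theory Defs
  imports "HOL-Analysis.Analysis"
begin

text \<open>
  Data of the mixed-integer program
  \<open>min c_d \<bullet> X\<^sub>d + c_c \<bullet> X\<^sub>c\<close> s.t. \<open>A_d X\<^sub>d + A_c X\<^sub>c \<le> b_a\<close>, \<open>B_d X\<^sub>d + G X\<^sub>c \<le> b_b\<close>,
  \<open>D_d X\<^sub>d \<le> b_c\<close>, with \<open>X\<^sub>d\<close> binary of dimension \<open>CARD('m)\<close> and \<open>X\<^sub>c\<close> real of dimension
  \<open>CARD('n)\<close>. The index types \<open>'a\<close>, \<open>'b\<close>, \<open>'c\<close> number the rows of the three constraint blocks;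
  \<open>\<le>\<close> on vectors is componentwise. \<open>G\<close> is an arbitrary function.
\<close>

record ('m::finite, 'n::finite, 'a::finite, 'b::finite, 'c::finite) mip =
  c_d :: "real ^ 'm"
  c_c :: "real ^ 'n"
  A_d :: "real ^ 'm ^ 'a"
  A_c :: "real ^ 'n ^ 'a"
  b_a :: "real ^ 'a"
  B_d :: "real ^ 'm ^ 'b"
  G   :: "real ^ 'n \<Rightarrow> real ^ 'b"
  b_b :: "real ^ 'b"
  D_d :: "real ^ 'm ^ 'c"
  b_c :: "real ^ 'c"

definition binary_vectors :: "(real ^ 'm) set" where
  "binary_vectors = {z. \<forall>i. z $ i = 0 \<or> z $ i = 1}"

definition unit_box :: "(real ^ 'm) set" where
  "unit_box = {z. \<forall>i. 0 \<le> z $ i \<and> z $ i \<le> 1}"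

definition feasible_set ::
  "('m::finite, 'n::finite, 'a::finite, 'b::finite, 'c::finite) mip \<Rightarrow> ((real ^ 'n) \<times> (real ^ 'm)) set"
  where
  "feasible_set P = {(Xc, Zd).
     A_d P *v Zd + A_c P *v Xc \<le> b_a P \<and>
     B_d P *v Zd + G P Xc \<le> b_b P \<and>
     D_d P *v Zd \<le> b_c P}"

text \<open>
  A triple \<open>(\<alpha>, \<tau>, \<gamma>)\<close> stands for the cut \<open>\<alpha> \<bullet> X\<^sub>d + \<tau> \<Theta> \<le> \<gamma>\<close>; this covers optimality cuts,
  feasibility cuts, bounds on \<open>\<Theta>\<close> and branching decisions. The set \<open>V\<close> is \<open>binary_vectors\<close> for the
  master problem itself and \<open>unit_box\<close> for its linear relaxation.
\<close>

definition bmp_feasible ::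
  "('m::finite, 'n::finite, 'a::finite, 'b::finite, 'c::finite) mip
     \<Rightarrow> ((real ^ 'm) \<times> real \<times> real) set \<Rightarrow> (real ^ 'm) set \<Rightarrow> ((real ^ 'm) \<times> real) set"
  where
  "bmp_feasible P cuts V = {(Xd, \<Theta>).
     Xd \<in> V \<and> D_d P *v Xd \<le> b_c P \<and> (\<forall>(\<alpha>, \<tau>, \<gamma>) \<in> cuts. \<alpha> \<bullet> Xd + \<tau> * \<Theta> \<le> \<gamma>)}"

definition bmp_solution ::
  "('m::finite, 'n::finite, 'a::finite, 'b::finite, 'c::finite) mip
     \<Rightarrow> ((real ^ 'm) \<times> real \<times> real) set \<Rightarrow> (real ^ 'm) set \<Rightarrow> real ^ 'm \<Rightarrow> bool"
  where
  "bmp_solution P cuts V Xd \<longleftrightarrow>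
     (\<exists>\<Theta>. is_arg_min (\<lambda>(X, T). c_d P \<bullet> X + T) (\<lambda>y. y \<in> bmp_feasible P cuts V) (Xd, \<Theta>))"

definition bsp_feasible ::
  "('m::finite, 'n::finite, 'a::finite, 'b::finite, 'c::finite) mip
     \<Rightarrow> real ^ 'm \<Rightarrow> ((real ^ 'n) \<times> (real ^ 'm)) set"
  where
  "bsp_feasible P Xstar = {(Xc, Zd) \<in> feasible_set P. Zd = Xstar}"

definition bsp_solution ::
  "('m::finite, 'n::finite, 'a::finite, 'b::finite, 'c::finite) mip
     \<Rightarrow> real ^ 'm \<Rightarrow> (real ^ 'n) \<times> (real ^ 'm) \<Rightarrow> bool"
  where
  "bsp_solution P Xstar =
     is_arg_min (\<lambda>(Xc, Zd). c_c P \<bullet> Xc) (\<lambda>y. y \<in> bsp_feasible P Xstar)"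

text \<open>Lagrangian of the subproblem with the single constraint \<open>Z\<^sub>d = X\<^sub>d\<^sup>*\<close> dualized.\<close>

definition bsp_lagrangian ::
  "('m::finite, 'n::finite, 'a::finite, 'b::finite, 'c::finite) mip
     \<Rightarrow> real ^ 'm \<Rightarrow> real ^ 'm \<Rightarrow> (real ^ 'n) \<times> (real ^ 'm) \<Rightarrow> real"
  where
  "bsp_lagrangian P Xstar \<zeta> = (\<lambda>(Xc, Zd). c_c P \<bullet> Xc - \<zeta> \<bullet> (Zd - Xstar))"

text \<open>
  Values in \<open>ereal\<close>: the dual function may be \<open>-\<infinity>\<close>, and an infeasible subproblem has
  value \<open>\<infinity>\<close>.
\<close>

definition bsp_value ::
  "('m::finite, 'n::finite, 'a::finite, 'b::finite, 'c::finite) mip \<Rightarrow> real ^ 'm \<Rightarrow> ereal" where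
  "bsp_value P Xstar = (INF (Xc, Zd) \<in> bsp_feasible P Xstar. ereal (c_c P \<bullet> Xc))"

definition bsp_dual_function ::
  "('m::finite, 'n::finite, 'a::finite, 'b::finite, 'c::finite) mip
     \<Rightarrow> real ^ 'm \<Rightarrow> real ^ 'm \<Rightarrow> ereal"
  where
  "bsp_dual_function P Xstar \<zeta> = (INF y \<in> feasible_set P. ereal (bsp_lagrangian P Xstar \<zeta> y))"

text \<open>
  Dual multipliers in the sense of Lagrangian duality (Bertsekas' geometric multipliers):
  the dual function attains the primal value. By weak duality such a \<open>\<zeta>\<close> solves the Lagrangian
  dual problem. As \<open>G\<close> need not be convex, local (Karush-Kuhn-Tucker) multipliers
  would not do: with a duality gap the generalized cut may lie above the strengthened one.
  The \<open>\<zeta>\<close>-part of a zero-gap multiplier vector for all constraints of the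
  subproblem is a multiplier in the present sense.
\<close>

definition bsp_dual_multiplier ::
  "('m::finite, 'n::finite, 'a::finite, 'b::finite, 'c::finite) mip
     \<Rightarrow> real ^ 'm \<Rightarrow> real ^ 'm \<Rightarrow> bool"
  where
  "bsp_dual_multiplier P Xstar \<zeta> \<longleftrightarrow> bsp_dual_function P Xstar \<zeta> = bsp_value P Xstar"

definition binary_feasible_set ::
  "('m::finite, 'n::finite, 'a::finite, 'b::finite, 'c::finite) mip \<Rightarrow> ((real ^ 'n) \<times> (real ^ 'm)) set"
  where
  "binary_feasible_set P = {(Xc, Zd) \<in> feasible_set P. Zd \<in> binary_vectors}"

definition strengthened_solution ::
  "('m::finite, 'n::finite, 'a::finite, 'b::finite, 'c::finite) mip
     \<Rightarrow> real ^ 'm \<Rightarrow> real ^ 'm \<Rightarrow> (real ^ 'n) \<times> (real ^ 'm) \<Rightarrow> bool"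
  where
  "strengthened_solution P Xstar \<zeta> =
     is_arg_min (\<lambda>(Xc, Zd). c_c P \<bullet> Xc - \<zeta> \<bullet> (Zd - Xstar)) (\<lambda>y. y \<in> binary_feasible_set P)"

text \<open>
  Right-hand side, as a function of \<open>X\<^sub>d\<close>, of the cut built from a point \<open>(X\<^sub>c, Z\<^sub>d)\<close> and \<open>\<zeta>\<close>.
\<close>

definition cut_rhs ::
  "('m::finite, 'n::finite, 'a::finite, 'b::finite, 'c::finite) mip
     \<Rightarrow> real ^ 'm \<Rightarrow> (real ^ 'n) \<times> (real ^ 'm) \<Rightarrow> real ^ 'm \<Rightarrow> real"
  where
  "cut_rhs P \<zeta> = (\<lambda>(Xc, Zd) Xd. c_c P \<bullet> Xc + \<zeta> \<bullet> (Xd - Zd))"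

definition affine_with_slope :: "real ^ 'm \<Rightarrow> (real ^ 'm \<Rightarrow> real) \<Rightarrow> bool" where
  "affine_with_slope s f \<longleftrightarrow> (\<exists>\<beta>. \<forall>X. f X = s \<bullet> X + \<beta>)"

definition parallel :: "(real ^ 'm \<Rightarrow> real) \<Rightarrow> (real ^ 'm \<Rightarrow> real) \<Rightarrow> bool" where
  "parallel f g \<longleftrightarrow> (\<exists>s. affine_with_slope s f \<and> affine_with_slope s g)"

definition tighter_by :: "real \<Rightarrow> (real ^ 'm \<Rightarrow> real) \<Rightarrow> (real ^ 'm \<Rightarrow> real) \<Rightarrow> bool" where
  "tighter_by \<xi> f g \<longleftrightarrow> (\<forall>X. f X \<ge> g X + \<xi>)"

text \<open>A genuine minimum: unspecified if the infimum is not attained.\<close>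

definition minimum :: "('x \<Rightarrow> real) \<Rightarrow> 'x set \<Rightarrow> real" where
  "minimum f S = (LEAST v. v \<in> f ` S)"

definition Xi ::
  "('m::finite, 'n::finite, 'a::finite, 'b::finite, 'c::finite) mip \<Rightarrow> real ^ 'm \<Rightarrow> real"
  where
  "Xi P \<zeta> =
     minimum (\<lambda>(Xc, Zd). c_c P \<bullet> Xc - \<zeta> \<bullet> Zd) (binary_feasible_set P)
     - minimum (\<lambda>(Xc, Zd). c_c P \<bullet> Xc - \<zeta> \<bullet> Zd) (feasible_set P)"

end

theory Submission
  imports Defs
begin

text \<open>
  The multiplier condition forces \<open>(Xbar, Zbar)\<close> to minimize the Lagrangian over the whole feasible set,
  so both cuts have the form \<open>\<zeta> \<bullet> X + v\<close> with \<open>v\<close> the minimum of \<open>c_c \<bullet> X\<^sub>c - \<zeta> \<bullet> Z\<^sub>d\<close> over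
  the respective set. The gap between the cuts is therefore exactly \<open>\<Xi>\<close>, which is nonnegative because
  the binary points form a subset.
\<close>

lemma minimum_eqI:
  assumes "x \<in> S" and "\<And>y. y \<in> S \<Longrightarrow> f x \<le> f y"
  shows "minimum f S = f x"
  unfolding minimum_def using assms by (intro Least_equality) auto

text \<open>Isolates the constant term, which is exactly the objective whose two minima define
  \<open>Xi\<close>.\<close>

lemma cut_rhs_eq: "cut_rhs P \<zeta> (Xc, Zd) X = \<zeta> \<bullet> X + (c_c P \<bullet> Xc - \<zeta> \<bullet> Zd)"
  by (simp add: cut_rhs_def inner_diff_right)

lemma parallel_cut_rhs: "parallel (cut_rhs P \<zeta> p) (cut_rhs P \<zeta> q)"
proof -
  have "affine_with_slope \<zeta> (cut_rhs P \<zeta> r)" for r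
    by (cases r) (auto simp: affine_with_slope_def cut_rhs_eq)
  then show ?thesis
    unfolding parallel_def by blast
qed

text \<open>Attainment makes the infimum finite, so the \<open>ereal\<close> equation in the
  multiplier condition can be read as one about reals.\<close>

lemma bsp_value_eq:
  assumes "bsp_solution P Xstar (Xbar, Zbar)"
  shows "bsp_value P Xstar = ereal (c_c P \<bullet> Xbar)"
  unfolding bsp_value_def
proof (rule antisym)
  show "(INF (Xc, Zd)\<in>bsp_feasible P Xstar. ereal (c_c P \<bullet> Xc)) \<le> ereal (c_c P \<bullet> Xbar)"
    using assms by (intro INF_lower2[of "(Xbar, Zbar)"]) (auto simp: bsp_solution_def is_arg_min_def)
  show "ereal (c_c P \<bullet> Xbar) \<le> (INF (Xc, Zd)\<in>bsp_feasible P Xstar. ereal (c_c P \<bullet> Xc))"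
    using assms by (intro INF_greatest) (force simp: bsp_solution_def is_arg_min_def not_less)
qed

text \<open>With zero gap the primal value equals the dual function, which bounds the Lagrangian
  from below at every feasible point. Since \<open>Zbar = Xstar\<close>, the constant
  \<open>\<zeta> \<bullet> Xstar\<close> becomes the term in \<open>Zbar\<close> on the
  left.\<close>

lemma bsp_solution_minimizes_lagrangian:
  assumes sol: "bsp_solution P Xstar (Xbar, Zbar)"
    and mult: "bsp_dual_multiplier P Xstar \<zeta>"
    and feas: "(Xc, Zd) \<in> feasible_set P"
  shows "c_c P \<bullet> Xbar - \<zeta> \<bullet> Zbar \<le> c_c P \<bullet> Xc - \<zeta> \<bullet> Zd"
proof -
  have Zbar: "Zbar = Xstar"
    using sol by (auto simp: bsp_solution_def is_arg_min_def bsp_feasible_def)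
  have "ereal (c_c P \<bullet> Xbar) = bsp_dual_function P Xstar \<zeta>"
    using mult bsp_value_eq[OF sol] by (simp add: bsp_dual_multiplier_def)
  also have "\<dots> \<le> ereal (bsp_lagrangian P Xstar \<zeta> (Xc, Zd))"
    unfolding bsp_dual_function_def by (rule INF_lower[OF feas])
  finally show ?thesis
    by (simp add: bsp_lagrangian_def Zbar inner_diff_right)
qed

theorem theorem1:
  fixes P :: "('m::finite, 'n::finite, 'a::finite, 'b::finite, 'c::finite) mip"
    and cuts :: "((real ^ 'm) \<times> real \<times> real) set"
    and Xstar \<zeta> Zbar Zs :: "real ^ 'm"
    and Xbar Xs :: "real ^ 'n"
  assumes "finite cuts"
    and "bmp_solution P cuts binary_vectors Xstar \<or> bmp_solution P cuts unit_box Xstar"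
    and "bsp_solution P Xstar (Xbar, Zbar)"
    and "bsp_dual_multiplier P Xstar \<zeta>"
    and "strengthened_solution P Xstar \<zeta> (Xs, Zs)"
  shows "parallel (cut_rhs P \<zeta> (Xs, Zs)) (cut_rhs P \<zeta> (Xbar, Zbar))
    \<and> Xi P \<zeta> \<ge> 0
    \<and> tighter_by (Xi P \<zeta>) (cut_rhs P \<zeta> (Xs, Zs)) (cut_rhs P \<zeta> (Xbar, Zbar))"
proof -
  let ?f = "\<lambda>(Xc, Zd). c_c P \<bullet> Xc - \<zeta> \<bullet> Zd"
  have bar: "(Xbar, Zbar) \<in> feasible_set P"
    using assms(3) by (auto simp: bsp_solution_def is_arg_min_def bsp_feasible_def)
  have s: "(Xs, Zs) \<in> binary_feasible_set P"
    using assms(5) by (auto simp: strengthened_solution_def is_arg_min_def)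
  \<comment> \<open>Attainment over the whole feasible set is not assumed; the subproblem solution
    supplies the minimizer.\<close>
  have relaxed: "minimum ?f (feasible_set P) = ?f (Xbar, Zbar)"
    using bsp_solution_minimizes_lagrangian[OF assms(3,4)] by (intro minimum_eqI bar) auto
  have binary: "minimum ?f (binary_feasible_set P) = ?f (Xs, Zs)"
  proof (intro minimum_eqI s)
    fix y assume "y \<in> binary_feasible_set P"
    then show "?f (Xs, Zs) \<le> ?f y"
      \<comment> \<open>The strengthened objective is \<open>?f\<close> plus the constant
        \<open>\<zeta> \<bullet> Xstar\<close>, so both have the same minimizers.\<close>
      using assms(5)
      by (cases y) (force simp: strengthened_solution_def is_arg_min_def not_less inner_diff_right)
  qed
  have gap: "Xi P \<zeta> = ?f (Xs, Zs) - ?f (Xbar, Zbar)"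
    by (simp only: Xi_def relaxed binary)
  have "(Xs, Zs) \<in> feasible_set P"
    using s by (simp add: binary_feasible_set_def)
  then have "Xi P \<zeta> \<ge> 0"
    using bsp_solution_minimizes_lagrangian[OF assms(3,4)] by (simp add: gap)
  moreover have "tighter_by (Xi P \<zeta>) (cut_rhs P \<zeta> (Xs, Zs)) (cut_rhs P \<zeta> (Xbar, Zbar))"
    by (simp add: tighter_by_def cut_rhs_eq gap)
  ultimately show ?thesis
    using parallel_cut_rhs by blast
qed

end
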